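(* Let $\mathcal F=(F,<,+,\cdot,0,1,\ldots)$ be a definably complete expansion of an ordered field. Let $(X,d)$ be a definable metric space, with $X$ equipped with the topology induced from the metric $d$. Let $A$ be a nonempty definable closed subset of $X$ and let $\varphi:A\to F$ be a bounded definable continuous function. Then there exists a definable continuous extension $\Phi:X\to F$ of $\varphi$.
   Context: Let $\mathcal F=(F,<,\ldots)$ be an expansion of a dense linear order without endpoints. "Definable" means definable in $\mathcal F$ with parameters; a definable map is a map between definable sets whose graph is definable. $F$ carries the order topology. $\mathcal F$ is definably complete if every definable subset of $F$ has both a supremum and an infimum in $F\cup\{\pm\infty\}$. A definable metric space is a pair $(X,d)$ of a definable set $X$ and a definable function $d:X\times X\to F$ which is an ($F$-valued) metric on $X$. Closedness of $A$ and continuity of $\varphi$ and $\Phi$ refer to the metric topology on $X$ (and its restriction to $A$) and the order topology on $F$. *)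

theory Defs
  imports "HOL-Analysis.Analysis" "HOL-Library.Extended" "HOL-Library.Lub_Glb"
begin

section \<open>Expansions of an ordered field\<close>

text \<open>
  Terms and formulas over the language of ordered fields \<open>(<, +, \<cdot>, 0, 1)\<close>, extended by
  function symbols of type \<open>'f\<close> and relation symbols of type \<open>'r\<close>. Variables are
  natural numbers. Subtraction and (totalised) division are not part of the language.
\<close>

datatype 'f trm =
    Var nat
  | Zero_const
  | One_const
  | Add "'f trm" "'f trm"
  | Mul "'f trm" "'f trm"
  | Fn 'f "'f trm list"

datatype ('f, 'r) fm =
    Eq "'f trm" "'f trm"
  | Less "'f trm" "'f trm"
  | Rel 'r "'f trm list"
  | Neg "('f, 'r) fm"
  | Conj "('f, 'r) fm" "('f, 'r) fm"
  | Exi nat "('f, 'r) fm"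

text \<open>
  An expansion of the ordered field carried by the type \<open>'a\<close>. A symbol belongs to the
  signature iff its arity is defined, so the signature may be empty; the interpretation of a
  symbol matters only on lists whose length is its arity.
\<close>

record ('f, 'r, 'a) expansion =
  fun_arity :: "'f \<Rightarrow> nat option"
  rel_arity :: "'r \<Rightarrow> nat option"
  fun_interp :: "'f \<Rightarrow> 'a list \<Rightarrow> 'a"
  rel_interp :: "'r \<Rightarrow> 'a list \<Rightarrow> bool"

primrec wf_trm :: "('f, 'r, 'a) expansion \<Rightarrow> 'f trm \<Rightarrow> bool" where
  "wf_trm F (Var i) \<longleftrightarrow> True"
| "wf_trm F Zero_const \<longleftrightarrow> True"
| "wf_trm F One_const \<longleftrightarrow> True"
| "wf_trm F (Add s t) \<longleftrightarrow> wf_trm F s \<and> wf_trm F t"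
| "wf_trm F (Mul s t) \<longleftrightarrow> wf_trm F s \<and> wf_trm F t"
| "wf_trm F (Fn f ts) \<longleftrightarrow> fun_arity F f = Some (length ts) \<and> list_all (wf_trm F) ts"

primrec wf_fm :: "('f, 'r, 'a) expansion \<Rightarrow> ('f, 'r) fm \<Rightarrow> bool" where
  "wf_fm F (Eq s t) \<longleftrightarrow> wf_trm F s \<and> wf_trm F t"
| "wf_fm F (Less s t) \<longleftrightarrow> wf_trm F s \<and> wf_trm F t"
| "wf_fm F (Rel r ts) \<longleftrightarrow> rel_arity F r = Some (length ts) \<and> list_all (wf_trm F) ts"
| "wf_fm F (Neg p) \<longleftrightarrow> wf_fm F p"
| "wf_fm F (Conj p q) \<longleftrightarrow> wf_fm F p \<and> wf_fm F q"
| "wf_fm F (Exi i p) \<longleftrightarrow> wf_fm F p"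

primrec val :: "('f, 'r, 'a::linordered_field) expansion \<Rightarrow> (nat \<Rightarrow> 'a) \<Rightarrow> 'f trm \<Rightarrow> 'a" where
  "val F v (Var i) = v i"
| "val F v Zero_const = 0"
| "val F v One_const = 1"
| "val F v (Add s t) = val F v s + val F v t"
| "val F v (Mul s t) = val F v s * val F v t"
| "val F v (Fn f ts) = fun_interp F f (map (val F v) ts)"

primrec sat :: "('f, 'r, 'a::linordered_field) expansion \<Rightarrow> (nat \<Rightarrow> 'a) \<Rightarrow> ('f, 'r) fm \<Rightarrow> bool" where
  "sat F v (Eq s t) \<longleftrightarrow> val F v s = val F v t"
| "sat F v (Less s t) \<longleftrightarrow> val F v s < val F v t"
| "sat F v (Rel r ts) \<longleftrightarrow> rel_interp F r (map (val F v) ts)"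
| "sat F v (Neg p) \<longleftrightarrow> \<not> sat F v p"
| "sat F v (Conj p q) \<longleftrightarrow> sat F v p \<and> sat F v q"
| "sat F v (Exi i p) \<longleftrightarrow> (\<exists>a. sat F (v(i := a)) p)"

section \<open>Definability with parameters\<close>

text \<open>
  Points of the \<open>n\<close>-th Cartesian power are lists of length \<open>n\<close>. The variables
  \<open>0, \<dots>, n - 1\<close> stand for the coordinates of the point; the remaining free variables of the
  formula, finitely many, are assigned parameters by \<open>c\<close>.
\<close>

definition definable :: "('f, 'r, 'a::linordered_field) expansion \<Rightarrow> nat \<Rightarrow> 'a list set \<Rightarrow> bool" where
  "definable F n S \<longleftrightarrow>
     (\<exists>p c. wf_fm F p \<and>
        S = {xs. length xs = n \<and> sat F (\<lambda>i. if i < n then xs ! i else c i) p})"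

definition definable_fun ::
    "('f, 'r, 'a::linordered_field) expansion \<Rightarrow> nat \<Rightarrow> 'a list set \<Rightarrow> ('a list \<Rightarrow> 'a) \<Rightarrow> bool" where
  "definable_fun F n X f \<longleftrightarrow>
     definable F n X \<and> definable F (n + 1) {xs @ [f xs] | xs. xs \<in> X}"

text \<open>
  Suprema and infima are taken in \<^typ>\<open>'a extended\<close>, the line with \<open>\<plusminus>\<infinity>\<close> adjoined; thus a
  set without upper bound in \<open>'a\<close> has supremum \<open>\<infinity>\<close>, and the empty set has supremum \<open>-\<infinity>\<close>.
\<close>

definition definably_complete :: "('f, 'r, 'a::linordered_field) expansion \<Rightarrow> bool" where
  "definably_complete F \<longleftrightarrow>
     (\<forall>D. definable F 1 {[a] | a. a \<in> D} \<longrightarrow>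
        (\<exists>s. isLub (UNIV :: 'a extended set) (Fin ` D) s) \<and>
        (\<exists>s. isGlb (UNIV :: 'a extended set) (Fin ` D) s))"

section \<open>Definable metric spaces\<close>

text \<open>
  The metrics of the library are real-valued; here they take values in an ordered field.
\<close>

definition metric_on :: "'b set \<Rightarrow> ('b \<Rightarrow> 'b \<Rightarrow> 'a::linordered_field) \<Rightarrow> bool" where
  "metric_on X d \<longleftrightarrow>
     (\<forall>x\<in>X. \<forall>y\<in>X. 0 \<le> d x y) \<and>
     (\<forall>x\<in>X. \<forall>y\<in>X. d x y = 0 \<longleftrightarrow> x = y) \<and>
     (\<forall>x\<in>X. \<forall>y\<in>X. d x y = d y x) \<and>
     (\<forall>x\<in>X. \<forall>y\<in>X. \<forall>z\<in>X. d x z \<le> d x y + d y z)"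

definition definable_metric_space ::
    "('f, 'r, 'a::linordered_field) expansion \<Rightarrow> nat \<Rightarrow> 'a list set \<Rightarrow> ('a list \<Rightarrow> 'a list \<Rightarrow> 'a) \<Rightarrow> bool" where
  "definable_metric_space F n X d \<longleftrightarrow>
     definable F n X \<and>
     definable F (n + n + 1) {xs @ ys @ [d xs ys] | xs ys. xs \<in> X \<and> ys \<in> X} \<and>
     metric_on X d"

definition metric_topology :: "'b set \<Rightarrow> ('b \<Rightarrow> 'b \<Rightarrow> 'a::linordered_field) \<Rightarrow> 'b topology" where
  "metric_topology X d =
     topology (\<lambda>U. U \<subseteq> X \<and> (\<forall>x\<in>U. \<exists>e>0. \<forall>y\<in>X. d x y < e \<longrightarrow> y \<in> U))"

lemma openin_metric_topology:
  "openin (metric_topology X d) U \<longleftrightarrow>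
     U \<subseteq> X \<and> (\<forall>x\<in>U. \<exists>e>0. \<forall>y\<in>X. d x y < e \<longrightarrow> y \<in> U)"
proof -
  have "istopology (\<lambda>U. U \<subseteq> X \<and> (\<forall>x\<in>U. \<exists>e>0. \<forall>y\<in>X. d x y < e \<longrightarrow> y \<in> U))"
    unfolding istopology_def
  proof (intro conjI allI impI)
    fix S T
    assume S: "S \<subseteq> X \<and> (\<forall>x\<in>S. \<exists>e>0. \<forall>y\<in>X. d x y < e \<longrightarrow> y \<in> S)"
      and T: "T \<subseteq> X \<and> (\<forall>x\<in>T. \<exists>e>0. \<forall>y\<in>X. d x y < e \<longrightarrow> y \<in> T)"
    show "S \<inter> T \<subseteq> X" using S by blast
    show "\<forall>x\<in>S \<inter> T. \<exists>e>0. \<forall>y\<in>X. d x y < e \<longrightarrow> y \<in> S \<inter> T"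
    proof
      fix x assume "x \<in> S \<inter> T"
      then obtain e e' where "e > 0" "\<forall>y\<in>X. d x y < e \<longrightarrow> y \<in> S"
        and "e' > 0" "\<forall>y\<in>X. d x y < e' \<longrightarrow> y \<in> T"
        using S T by blast
      then show "\<exists>e>0. \<forall>y\<in>X. d x y < e \<longrightarrow> y \<in> S \<inter> T"
        by (intro exI[of _ "min e e'"]) auto
    qed
  next
    fix K :: "'a set set"
    assume K: "\<forall>U\<in>K. U \<subseteq> X \<and> (\<forall>x\<in>U. \<exists>e>0. \<forall>y\<in>X. d x y < e \<longrightarrow> y \<in> U)"
    then show "\<Union>K \<subseteq> X" by blast
    show "\<forall>x\<in>\<Union>K. \<exists>e>0. \<forall>y\<in>X. d x y < e \<longrightarrow> y \<in> \<Union>K"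
      using K by (meson UnionE UnionI)
  qed
  then show ?thesis
    by (simp add: metric_topology_def)
qed

lemma topspace_metric_topology [simp]: "topspace (metric_topology X d) = X"
proof
  show "topspace (metric_topology X d) \<subseteq> X"
    using openin_metric_topology[of X d "topspace (metric_topology X d)"] by simp
  have "openin (metric_topology X d) X"
    unfolding openin_metric_topology by (auto intro: exI[of _ 1])
  then show "X \<subseteq> topspace (metric_topology X d)"
    by (rule openin_subset)
qed

end

(* Hausdorff's extension formula. After adding a constant, 1 <= phi <= K on A; off A put
   Phi x = N x / D x with N x = inf {phi a * d x a | a in A} and D x = inf {d x a | a in A}.
   Definable completeness provides both infima, and they are Lipschitz in x, so Phi is
   continuous off A. When x is close to a in A, points of A far from a do not affect
   either infimum, so Phi x is close to phi a. *)
theory Submission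
  imports Defs
begin

section \<open>Renaming and substituting variables\<close>

text \<open>Definable completeness speaks only about definable sets, so the infima must be defined
  before they exist: for fixed \<open>x\<close> the values \<open>w a * d x a\<close> have to form a
  definable subset of the line, and afterwards \<open>N\<close> and \<open>D\<close> need definable
  graphs. Formulas come with fixed positions for the coordinates and clash when combined; predicates
  on valuations absorb this bookkeeping. The two bounds have separate roles. The upper bound
  \<open>K\<close> makes \<open>N\<close> Lipschitz and limits the contribution
  \<open>g a * d x a\<close> of a point \<open>a\<close> close to \<open>x\<close>. The lower bound
  1 forces a point \<open>b\<close> far from \<open>a\<close> to contribute at least
  \<open>d x b\<close>, so that it cannot undercut \<open>a\<close>. Closedness of \<open>A\<close>
  makes \<open>D\<close> positive off \<open>A\<close>. Since \<open>D\<close> has no positive lower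
  bound near a point of \<open>A\<close>, Lipschitz estimates do not control the quotient there;
  \<open>N\<close> is instead compared with multiples of \<open>D\<close> term by term.\<close>

primrec rename_trm :: "(nat \<Rightarrow> nat) \<Rightarrow> 'f trm \<Rightarrow> 'f trm" where
  "rename_trm r (Var i) = Var (r i)"
| "rename_trm r Zero_const = Zero_const"
| "rename_trm r One_const = One_const"
| "rename_trm r (Add s t) = Add (rename_trm r s) (rename_trm r t)"
| "rename_trm r (Mul s t) = Mul (rename_trm r s) (rename_trm r t)"
| "rename_trm r (Fn f ts) = Fn f (map (rename_trm r) ts)"

primrec rename_fm :: "(nat \<Rightarrow> nat) \<Rightarrow> ('f, 'r) fm \<Rightarrow> ('f, 'r) fm" where
  "rename_fm r (Eq s t) = Eq (rename_trm r s) (rename_trm r t)"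
| "rename_fm r (Less s t) = Less (rename_trm r s) (rename_trm r t)"
| "rename_fm r (Rel R ts) = Rel R (map (rename_trm r) ts)"
| "rename_fm r (Neg p) = Neg (rename_fm r p)"
| "rename_fm r (Conj p q) = Conj (rename_fm r p) (rename_fm r q)"
| "rename_fm r (Exi i p) = Exi (r i) (rename_fm r p)"

lemma wf_rename_trm: "wf_trm F (rename_trm r t) = wf_trm F t"
  by (induction t) (auto simp: list_all_iff)

lemma wf_rename_fm: "wf_fm F (rename_fm r p) = wf_fm F p"
  by (induction p) (auto simp: list_all_iff wf_rename_trm)

lemma val_rename_trm: "val F v (rename_trm r t) = val F (v \<circ> r) t"
proof (induction t)
  case (Fn f ts)
  then have "map (val F v) (map (rename_trm r) ts) = map (val F (v \<circ> r)) ts"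
    unfolding map_map by (intro map_cong refl) (simp add: o_def)
  then show ?case by (simp only: rename_trm.simps val.simps)
qed auto

text \<open>Bound variables are renamed too. Injectivity of \<open>r\<close> prevents capture: no
  other variable is sent to the image of a quantified one.\<close>

lemma sat_rename_fm:
  assumes "inj r"
  shows "sat F v (rename_fm r p) = sat F (v \<circ> r) p"
proof (induction p arbitrary: v)
  case (Exi i p)
  have "v(r i := a) \<circ> r = (v \<circ> r)(i := a)" for a
    using assms by (auto simp: fun_eq_iff inj_eq)
  with Exi show ?case by (simp only: rename_fm.simps sat.simps)
next
  case (Rel R ts)
  have "map (val F v) (map (rename_trm r) ts) = map (val F (v \<circ> r)) ts"
    by (simp add: val_rename_trm)
  then show ?case by (simp only: rename_fm.simps sat.simps)
qed (auto simp: val_rename_trm)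

text \<open>A semantic substitute for the finite set of free variables. The value type is arbitrary,
  so the same composition lemmas serve terms, argument lists and formulas.\<close>

definition finitely_supported :: "((nat \<Rightarrow> 'a) \<Rightarrow> 'b) \<Rightarrow> bool" where
  "finitely_supported g \<longleftrightarrow> (\<exists>N. \<forall>v v'. (\<forall>i<N. v i = v' i) \<longrightarrow> g v = g v')"

lemma finitely_supported_const: "finitely_supported (\<lambda>v. c)"
  by (simp add: finitely_supported_def)

lemma finitely_supported_comp:
  "finitely_supported f \<Longrightarrow> finitely_supported (\<lambda>v. h (f v))"
  unfolding finitely_supported_def by metis

lemma finitely_supported_comp2:
  assumes "finitely_supported f" "finitely_supported g"
  shows "finitely_supported (\<lambda>v. h (f v) (g v))"
proof -
  obtain M N where "\<And>v v'. (\<forall>i<M. v i = v' i) \<Longrightarrow> f v = f v'" "\<And>v v'. (\<forall>i<N. v i = v' i) \<Longrightarrow> g v = g v'"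
    using assms unfolding finitely_supported_def by metis
  then have "h (f v) (g v) = h (f v') (g v')" if "\<forall>i<max M N. v i = v' i" for v v'
    using that by (metis less_max_iff_disj)
  then show ?thesis
    unfolding finitely_supported_def by blast
qed

lemma finitely_supported_map:
  "(\<And>t. t \<in> set ts \<Longrightarrow> finitely_supported (\<lambda>v. g v t)) \<Longrightarrow> finitely_supported (\<lambda>v. map (g v) ts)"
proof (induction ts)
  case Nil
  then show ?case by (simp add: finitely_supported_const)
next
  case (Cons t ts)
  then show ?case
    using finitely_supported_comp2[of "\<lambda>v. g v t" "\<lambda>v. map (g v) ts" Cons] by simp
qed

lemma finitely_supported_val: "finitely_supported (\<lambda>v. val F v t)"
proof (induction t)
  case (Var i)
  then show ?case by (auto simp: finitely_supported_def intro: exI[of _ "Suc i"])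
next
  case (Fn f ts)
  then show ?case
    using finitely_supported_comp[OF finitely_supported_map[of ts "val F"], of "fun_interp F f"]
    by simp
qed (simp_all add: finitely_supported_const
  finitely_supported_comp2[where h = "(+)"] finitely_supported_comp2[where h = "(*)"])

lemma finitely_supported_sat: "finitely_supported (\<lambda>v. sat F v p)"
proof (induction p)
  case (Rel R ts)
  show ?case
    using finitely_supported_comp[OF finitely_supported_map[of ts "val F"], of "rel_interp F R"]
    by (simp add: finitely_supported_val)
next
  case (Exi j p)
  then obtain N where N: "\<And>v v'. (\<forall>i<N. v i = v' i) \<Longrightarrow> sat F v p = sat F v' p"
    unfolding finitely_supported_def by blast
  have "sat F (v(j := a)) p = sat F (v'(j := a)) p" if "\<forall>i<N. v i = v' i" for v v' a
    using that by (intro N) auto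
  then show ?case unfolding finitely_supported_def sat.simps by blast
qed (simp_all add: finitely_supported_val finitely_supported_comp[where h = Not]
  finitely_supported_comp2[where h = "(=)"] finitely_supported_comp2[where h = "(<)"]
  finitely_supported_comp2[where h = "(\<and>)"])

text \<open>Substitution without descending into \<open>p\<close>: each \<open>k\<close> in
  \<open>I\<close> is bound by an outer quantifier that forces it to equal \<open>f k\<close>. As no
  \<open>f i\<close> lies in \<open>I\<close>, these quantifiers leave the substituted values
  untouched.\<close>

lemma formula_substitution:
  assumes "finite I" "\<And>i. i \<in> I \<Longrightarrow> f i \<notin> I" "wf_fm F p"
  shows "\<exists>q. wf_fm F q \<and> (\<forall>v. sat F v q = sat F (override_on v (\<lambda>i. v (f i)) I) p)"
  using assms(1,2)
proof (induction I)
  case empty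
  then show ?case using assms(3) by auto
next
  case (insert k I)
  then obtain q where q: "wf_fm F q" "\<And>v. sat F v q = sat F (override_on v (\<lambda>i. v (f i)) I) p"
    by blast
  have f: "f i \<noteq> k" if "i \<in> insert k I" for i
    using insert.prems that by auto
  have "override_on (v(k := v (f k))) (\<lambda>i. (v(k := v (f k))) (f i)) I = override_on v (\<lambda>i. v (f i)) (insert k I)" for v :: "nat \<Rightarrow> 'c"
    using f insert.hyps by (auto simp: override_on_def fun_eq_iff)
  then have "sat F v (Exi k (Conj (Eq (Var k) (Var (f k))) q))
      = sat F (override_on v (\<lambda>i. v (f i)) (insert k I)) p" for v
    using f[of k] unfolding sat.simps val.simps q(2) by (metis fun_upd_same fun_upd_other insertI1)
  then show ?case
    using q(1) by (intro exI[of _ "Exi k (Conj (Eq (Var k) (Var (f k))) q)"] conjI allI) simp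
qed

section \<open>Definable predicates on valuations\<close>

text \<open>
  Variables of a formula are either coordinates of the valuation or parameters, as chosen by
  \<open>s\<close>. Since \<open>s\<close> need not be injective, substitution of variables costs nothing.
\<close>

definition definable_pred ::
    "('f, 'r, 'a::linordered_field) expansion \<Rightarrow> ((nat \<Rightarrow> 'a) \<Rightarrow> bool) \<Rightarrow> bool" where
  "definable_pred F P \<longleftrightarrow>
     (\<exists>p (s :: nat \<Rightarrow> nat + 'a). wf_fm F p \<and> (\<forall>v. P v \<longleftrightarrow> sat F (case_sum v id \<circ> s) p))"

lemma definable_predI:
  assumes "wf_fm F p" "\<And>v. P v \<longleftrightarrow> sat F (case_sum v id \<circ> s) p"
  shows "definable_pred F P"
  using assms unfolding definable_pred_def by blast

lemma definable_pred_subst: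
  assumes "definable_pred F P"
  shows "definable_pred F (\<lambda>v. P (case_sum v id \<circ> t))"
proof -
  obtain p s where p: "wf_fm F p" "\<And>v. P v \<longleftrightarrow> sat F (case_sum v id \<circ> s) p"
    using assms unfolding definable_pred_def by blast
  have "case_sum (case_sum v id \<circ> t) id \<circ> s = case_sum v id \<circ> (case_sum t Inr \<circ> s)" for v :: "nat \<Rightarrow> 'c"
    by (auto simp: fun_eq_iff split: sum.split)
  with p show ?thesis
    by (intro definable_predI[of _ p _ "case_sum t Inr \<circ> s"]) simp_all
qed

lemma definable_pred_not:
  assumes "definable_pred F P"
  shows "definable_pred F (\<lambda>v. \<not> P v)"
proof -
  obtain p s where "wf_fm F p" "\<And>v. P v \<longleftrightarrow> sat F (case_sum v id \<circ> s) p"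
    using assms unfolding definable_pred_def by blast
  then show ?thesis
    by (intro definable_predI[of _ "Neg p" _ s]) simp_all
qed

lemma definable_pred_conj:
  assumes "definable_pred F P" "definable_pred F Q"
  shows "definable_pred F (\<lambda>v. P v \<and> Q v)"
proof -
  obtain p s where p: "wf_fm F p" "\<And>v. P v \<longleftrightarrow> sat F (case_sum v id \<circ> s) p"
    using assms(1) unfolding definable_pred_def by blast
  obtain q t where q: "wf_fm F q" "\<And>v. Q v \<longleftrightarrow> sat F (case_sum v id \<circ> t) q"
    using assms(2) unfolding definable_pred_def by blast
  \<comment> \<open>The two formulas may use one variable for different coordinates or parameters.
    Even variables are reserved for \<open>p\<close>, odd ones for \<open>q\<close>.\<close>
  define u where "u i = (if even i then s (i div 2) else t (i div 2))" for i
  have inj: "inj (\<lambda>i::nat. 2 * i)" "inj (\<lambda>i::nat. Suc (2 * i))"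
    by (auto simp: inj_def)
  have u: "u \<circ> (\<lambda>i. 2 * i) = s" "u \<circ> (\<lambda>i. Suc (2 * i)) = t"
    by (auto simp: u_def fun_eq_iff)
  show ?thesis
  proof (rule definable_predI)
    show "wf_fm F (Conj (rename_fm (\<lambda>i. 2 * i) p) (rename_fm (\<lambda>i. Suc (2 * i)) q))"
      using p q by (simp add: wf_rename_fm)
    show "(P v \<and> Q v) \<longleftrightarrow> sat F (case_sum v id \<circ> u)
        (Conj (rename_fm (\<lambda>i. 2 * i) p) (rename_fm (\<lambda>i. Suc (2 * i)) q))" for v
      unfolding sat.simps sat_rename_fm[OF inj(1)] sat_rename_fm[OF inj(2)] p q
      by (simp only: comp_assoc u)
  qed
qed

lemma definable_pred_disj:
  "definable_pred F P \<Longrightarrow> definable_pred F Q \<Longrightarrow> definable_pred F (\<lambda>v. P v \<or> Q v)"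
  using definable_pred_not[OF definable_pred_conj[OF definable_pred_not definable_pred_not]] by simp

lemma definable_pred_ex:
  assumes "definable_pred F P"
  shows "definable_pred F (\<lambda>v. \<exists>a. P (v(j := a)))"
proof -
  obtain p s where p: "wf_fm F p" "\<And>v. P v \<longleftrightarrow> sat F (case_sum v id \<circ> s) p"
    using assms unfolding definable_pred_def by blast
  obtain N where N: "\<And>v v'. (\<forall>i<N. v i = v' i) \<Longrightarrow> sat F v p = sat F v' p"
    using finitely_supported_sat[of F p] unfolding finitely_supported_def by blast
  \<comment> \<open>Several variables may stand for coordinate \<open>j\<close>; all become variable 0, left unused by \<open>rename_fm Suc\<close>.\<close>
  define I where "I = Suc ` {i. i < N \<and> s i = Inl j}"
  obtain q where q: "wf_fm F q"
    "\<And>v. sat F v q = sat F (override_on v (\<lambda>_. v 0) I) (rename_fm Suc p)"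
    using formula_substitution[of I "\<lambda>_. 0" F "rename_fm Suc p"] p(1)
    by (auto simp: I_def wf_rename_fm)
  define t where "t = case_nat (Inl 0) s"
  have "sat F ((case_sum v id \<circ> t)(0 := a)) q = P (v(j := a))" for v a
  proof -
    define w where "w = (case_sum v id \<circ> t)(0 := a)"
    have "sat F w q = sat F (override_on w (\<lambda>_. w 0) I \<circ> Suc) p"
      by (simp only: q sat_rename_fm[OF inj_Suc])
    also have "\<dots> = sat F (case_sum (v(j := a)) id \<circ> s) p"
      by (intro N) (auto simp: w_def t_def I_def override_on_def split: sum.split)
    finally show ?thesis by (simp only: p w_def)
  qed
  then show ?thesis
    using q(1) by (intro definable_predI[of _ "Exi 0 q" _ t]) simp_all
qed

text \<open>Quantifying over a point of \<open>A\<close> means quantifying over all its coordinates;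
  this handles the whole block at once.\<close>

lemma definable_pred_ex_override:
  assumes "finite I" "definable_pred F P"
  shows "definable_pred F (\<lambda>v. \<exists>u. P (override_on v u I))"
  using assms(1)
proof (induction I)
  case empty
  then show ?case using assms(2) by simp
next
  case (insert k I)
  have "(\<exists>a u. P (override_on (v(k := a)) u I)) = (\<exists>u. P (override_on v u (insert k I)))" for v
  proof
    assume "\<exists>a u. P (override_on (v(k := a)) u I)"
    then obtain a u where "P (override_on (v(k := a)) u I)" by blast
    moreover have "override_on (v(k := a)) u I = override_on v (u(k := a)) (insert k I)"
      using insert.hyps by (auto simp: override_on_def fun_eq_iff)
    ultimately show "\<exists>u. P (override_on v u (insert k I))" by metis
  next
    assume "\<exists>u. P (override_on v u (insert k I))"
    then obtain u where "P (override_on v u (insert k I))" by blast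
    moreover have "override_on (v(k := u k)) u I = override_on v u (insert k I)"
      by (auto simp: override_on_def fun_eq_iff)
    ultimately show "\<exists>a u. P (override_on (v(k := a)) u I)" by metis
  qed
  with definable_pred_ex[OF insert.IH, of k] show ?case by (simp only:)
qed

text \<open>The bridge to closure under logical operations. The converse is the delicate half:
  \<open>definable\<close> demands that coordinate \<open>j\<close> be variable \<open>j\<close>,
  whereas \<open>s\<close> may represent it by several variables or by others.\<close>

lemma definable_iff_pred:
  "definable F n S \<longleftrightarrow>
     (\<forall>xs\<in>S. length xs = n) \<and> definable_pred F (\<lambda>v. map v [0..<n] \<in> S)" (is "?L \<longleftrightarrow> ?R")
proof
  assume ?L
  then obtain p c where p: "wf_fm F p"
    "S = {xs. length xs = n \<and> sat F (\<lambda>i. if i < n then xs ! i else c i) p}"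
    unfolding definable_def by blast
  have "map v [0..<n] \<in> S \<longleftrightarrow> sat F (case_sum v id \<circ> (\<lambda>i. if i < n then Inl i else Inr (c i))) p" for v
  proof -
    have "(\<lambda>i. if i < n then map v [0..<n] ! i else c i)
        = case_sum v id \<circ> (\<lambda>i. if i < n then Inl i else Inr (c i))"
      by (auto simp: fun_eq_iff)
    then show ?thesis by (simp add: p(2))
  qed
  then show ?R
    using definable_predI[OF p(1)] by (auto simp: p(2) simp del: o_apply)
next
  assume R: ?R
  then obtain p s where p: "wf_fm F p" "\<And>v. map v [0..<n] \<in> S \<longleftrightarrow> sat F (case_sum v id \<circ> s) p"
    unfolding definable_pred_def by blast
  obtain N where N: "\<And>v v'. (\<forall>i<N. v i = v' i) \<Longrightarrow> sat F v p = sat F v' p"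
    using finitely_supported_sat[of F p] unfolding finitely_supported_def by blast
  \<comment> \<open>Shifting \<open>p\<close> by \<open>n\<close> frees the first \<open>n\<close>
    variables for the coordinates; \<open>I\<close> collects the shifted variables that stand for
    some coordinate \<open>j < n\<close>, each to be replaced by variable \<open>j\<close>. Only
    variables below \<open>N\<close> matter, so \<open>I\<close> is finite.\<close>
  define I where "I = (\<lambda>i. i + n) ` {i. i < N \<and> (\<exists>j<n. s i = Inl j)}"
  define f where "f i = projl (s (i - n))" for i
  have "finite I" "\<And>i. i \<in> I \<Longrightarrow> f i \<notin> I"
    by (auto simp: I_def f_def)
  then obtain q where q: "wf_fm F q"
    "\<And>v. sat F v q = sat F (override_on v (\<lambda>i. v (f i)) I) (rename_fm (\<lambda>i. i + n) p)"
    using formula_substitution[of I f F "rename_fm (\<lambda>i. i + n) p"] p(1)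
    unfolding wf_rename_fm by blast
  \<comment> \<open>Coordinates from \<open>n\<close> on cannot affect whether
    \<open>map v [0..<n]\<close> lies in \<open>S\<close>, so they may be set to 0.\<close>
  define c where "c i = case_sum (\<lambda>_. 0) id (s (i - n))" for i
  have "xs \<in> S \<longleftrightarrow> sat F (\<lambda>i. if i < n then xs ! i else c i) q" if "length xs = n" for xs
  proof -
    define w where "w = (\<lambda>i. if i < n then xs ! i else c i)"
    define v where "v i = (if i < n then xs ! i else 0)" for i
    have "sat F w q = sat F (override_on w (\<lambda>i. w (f i)) I \<circ> (\<lambda>i. i + n)) p"
      by (simp add: q sat_rename_fm)
    also have "\<dots> = sat F (case_sum v id \<circ> s) p"
      by (intro N) (auto simp: w_def v_def c_def f_def I_def override_on_def split: sum.split)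
    also have "\<dots> \<longleftrightarrow> map v [0..<n] \<in> S"
      by (simp add: p)
    also have "map v [0..<n] = xs"
      using that by (auto simp: v_def list_eq_iff_nth_eq)
    finally show ?thesis by (simp add: w_def)
  qed
  with R have "S = {xs. length xs = n \<and> sat F (\<lambda>i. if i < n then xs ! i else c i) q}"
    by auto
  with q(1) show ?L
    unfolding definable_def by blast
qed

lemma definable_pred_mem:
  assumes "definable F n S" "length js = n"
  shows "definable_pred F (\<lambda>v. map v js \<in> S)"
proof -
  have "map (case_sum v id \<circ> (\<lambda>i. Inl (js ! i))) [0..<n] = map v js" for v :: "nat \<Rightarrow> 'c"
    using assms(2) by (auto simp: list_eq_iff_nth_eq)
  then show ?thesis
    using assms(1) definable_pred_subst[of F "\<lambda>v. map v [0..<n] \<in> S" "\<lambda>i. Inl (js ! i)"]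
    by (simp add: definable_iff_pred)
qed

lemma definable_pred_atomic:
  "definable_pred F (\<lambda>v. v i < v j)"
  "definable_pred F (\<lambda>v. v i = c)"
  "definable_pred F (\<lambda>v. v i = v j + c)"
  "definable_pred F (\<lambda>v. v i = v j * v k)"
proof -
  show "definable_pred F (\<lambda>v. v i < v j)"
    by (rule definable_predI[of _ "Less (Var 0) (Var 1)" _ "\<lambda>l. [Inl i, Inl j] ! l"]) simp_all
  show "definable_pred F (\<lambda>v. v i = c)"
    by (rule definable_predI[of _ "Eq (Var 0) (Var 1)" _ "\<lambda>l. [Inl i, Inr c] ! l"]) simp_all
  show "definable_pred F (\<lambda>v. v i = v j + c)"
    by (rule definable_predI[of _ "Eq (Var 0) (Add (Var 1) (Var 2))" _ "\<lambda>l. [Inl i, Inl j, Inr c] ! l"]) simp_all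
  show "definable_pred F (\<lambda>v. v i = v j * v k)"
    by (rule definable_predI[of _ "Eq (Var 0) (Mul (Var 1) (Var 2))" _ "\<lambda>l. [Inl i, Inl j, Inl k] ! l"]) simp_all
qed

section \<open>Operations on definable functions\<close>

lemma definable_fun_iff:
  "definable_fun F n X f \<longleftrightarrow> definable F n X \<and>
     definable_pred F (\<lambda>v. map v [0..<n] \<in> X \<and> v n = f (map v [0..<n]))"
proof -
  have "length xs = n + 1" if "definable F n X" "xs \<in> {xs @ [f xs] | xs. xs \<in> X}" for xs
    using that by (auto simp: definable_def)
  moreover have "(map v [0..<n + 1] \<in> {xs @ [f xs] | xs. xs \<in> X}) =
     (map v [0..<n] \<in> X \<and> v n = f (map v [0..<n]))" for v
    by auto
  ultimately show ?thesis
    unfolding definable_fun_def definable_iff_pred[of F "n + 1"] by (simp only:) blast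
qed

lemma definable_fun_domain: "definable_fun F n X f \<Longrightarrow> definable F n X"
  by (simp add: definable_fun_def)

lemma definable_pred_graph:
  assumes "definable_fun F n X f" "length js = n"
  shows "definable_pred F (\<lambda>v. map v js \<in> X \<and> v k = f (map v js))"
proof -
  have "map v (js @ [k]) \<in> {xs @ [f xs] | xs. xs \<in> X} \<longleftrightarrow> map v js \<in> X \<and> v k = f (map v js)" for v
    by auto
  moreover have "definable_pred F (\<lambda>v. map v (js @ [k]) \<in> {xs @ [f xs] | xs. xs \<in> X})"
    using assms by (intro definable_pred_mem) (auto simp: definable_fun_def)
  ultimately show ?thesis by (simp only:)
qed

lemma definable_pred_reindex:
  fixes F :: "('f, 'r, 'a::linordered_field) expansion"
  assumes "definable_pred F (\<lambda>v. Q (map v [0..<n]) (v n))"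
  shows "definable_pred F (\<lambda>v. Q (map v [0..<n]) (v k))"
proof -
  have "map (case_sum v id \<circ> (\<lambda>i. Inl (if i = n then k else i))) [0..<n] = map v [0..<n]"
    for v :: "nat \<Rightarrow> 'a"
    by auto
  with definable_pred_subst[OF assms, of "\<lambda>i. Inl (if i = n then k else i)"] show ?thesis
    by (simp del: map_eq_conv)
qed

text \<open>The values of \<open>f\<close> and \<open>g\<close> are stored in the fresh coordinates
  \<open>n + 1\<close> and \<open>n + 2\<close> and then quantified away. Describing
  \<open>h\<close> by a relation instead of a term also covers division, which is not in the
  language.\<close>

lemma definable_fun_compose2:
  assumes f: "definable_fun F n X f" and g: "definable_fun F n X g"
    and R: "definable_pred F (\<lambda>v. R (v 0) (v 1) (v 2))"
    and h: "\<And>x y. x \<in> X \<Longrightarrow> y = h x \<longleftrightarrow> R (f x) (g x) y"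
  shows "definable_fun F n X h"
proof -
  have "definable_pred F (\<lambda>v. R (v (n + 1)) (v (n + 2)) (v n))"
    using definable_pred_subst[OF R, of "\<lambda>i. Inl ([n + 1, n + 2, n] ! i)"] by simp
  moreover have "definable_pred F (\<lambda>v. map v [0..<n] \<in> X \<and> v (n + 1) = f (map v [0..<n]))"
    "definable_pred F (\<lambda>v. map v [0..<n] \<in> X \<and> v (n + 2) = g (map v [0..<n]))"
    by (rule definable_pred_graph[OF f] definable_pred_graph[OF g], simp)+
  ultimately have "definable_pred F (\<lambda>v.
      (map v [0..<n] \<in> X \<and> v (n + 1) = f (map v [0..<n])) \<and>
      (map v [0..<n] \<in> X \<and> v (n + 2) = g (map v [0..<n])) \<and> R (v (n + 1)) (v (n + 2)) (v n))"
    by (rule definable_pred_conj[OF _ definable_pred_conj, rotated 2])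
  from definable_pred_ex[OF definable_pred_ex[OF this, of "n + 1"], of "n + 2"]
  have "definable_pred F (\<lambda>v. map v [0..<n] \<in> X \<and> R (f (map v [0..<n])) (g (map v [0..<n])) (v n))"
    by (simp cong: conj_cong)
  moreover have "(map v [0..<n] \<in> X \<and> R (f (map v [0..<n])) (g (map v [0..<n])) (v n)) =
      (map v [0..<n] \<in> X \<and> v n = h (map v [0..<n]))" for v
    using h by blast
  ultimately show ?thesis
    using definable_fun_domain[OF f] unfolding definable_fun_iff by (simp only:)
qed

lemma definable_fun_const:
  assumes "definable F n X"
  shows "definable_fun F n X (\<lambda>_. c)"
  using assms unfolding definable_fun_iff
  by (intro conjI definable_pred_conj definable_pred_mem definable_pred_atomic) auto

lemma definable_fun_add_const:
  assumes "definable_fun F n X f"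
  shows "definable_fun F n X (\<lambda>x. f x + c)"
  by (rule definable_fun_compose2[OF assms assms, of "\<lambda>a b y. y = a + c"])
    (simp_all add: definable_pred_atomic)

lemma definable_fun_divide:
  assumes "definable_fun F n X f" "definable_fun F n X g"
  shows "definable_fun F n X (\<lambda>x. f x / g x)"
proof (rule definable_fun_compose2[OF assms])
  \<comment> \<open>Division is expressed by multiplication; the first disjunct records the
    convention that division by 0 gives 0.\<close>
  show "definable_pred F (\<lambda>v. (v 1 = 0 \<and> v 2 = 0) \<or> (\<not> v 1 = 0 \<and> v 0 = v 1 * v 2))"
    by (intro definable_pred_disj definable_pred_conj definable_pred_not definable_pred_atomic)
  show "y = f x / g x \<longleftrightarrow> (g x = 0 \<and> y = 0) \<or> (\<not> g x = 0 \<and> f x = g x * y)" for x y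
    by (cases "g x = 0") (auto simp: field_simps)
qed

lemma definable_fun_if:
  assumes f: "definable_fun F n A f" and g: "definable_fun F n X g" and "A \<subseteq> X"
  shows "definable_fun F n X (\<lambda>x. if x \<in> A then f x else g x)"
proof -
  have "definable_pred F (\<lambda>v. (map v [0..<n] \<in> A \<and> v n = f (map v [0..<n])) \<or>
      \<not> map v [0..<n] \<in> A \<and> map v [0..<n] \<in> X \<and> v n = g (map v [0..<n]))"
    using definable_pred_mem[OF definable_fun_domain[OF f]]
    by (intro definable_pred_disj definable_pred_conj[of F "\<lambda>v. \<not> map v [0..<n] \<in> A"]
        definable_pred_not definable_pred_graph[OF f] definable_pred_graph[OF g]) simp_all
  moreover have "((map v [0..<n] \<in> A \<and> v n = f (map v [0..<n])) \<or>
      \<not> map v [0..<n] \<in> A \<and> map v [0..<n] \<in> X \<and> v n = g (map v [0..<n])) =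
      (map v [0..<n] \<in> X \<and> v n = (if map v [0..<n] \<in> A then f (map v [0..<n]) else g (map v [0..<n])))" for v
    using \<open>A \<subseteq> X\<close> by auto
  ultimately show ?thesis
    using definable_fun_domain[OF g] unfolding definable_fun_iff by (simp only:)
qed

section \<open>Definability of infima\<close>

lemma isGlb_UNIV_iff:
  "isGlb UNIV S l \<longleftrightarrow> (\<forall>y\<in>S. l \<le> y) \<and> (\<forall>m. (\<forall>y\<in>S. m \<le> y) \<longrightarrow> m \<le> l)"
  by (auto simp: isGlb_def isLb_def greatestP_def setge_def setle_def)

text \<open>In a linear order, being the greatest lower bound is first-order: no element lies below,
  and no larger bound has this property. Coordinate \<open>n + 1\<close> can serve as witness in
  both quantifiers because the first has already bound it.\<close>

lemma definable_pred_isGlb: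
  assumes "definable_pred F (\<lambda>v. R (map v [0..<n]) (v n))"
  shows "definable_pred F (\<lambda>v. isGlb UNIV {e. R (map v [0..<n]) e} (v n))"
proof -
  have "definable_pred F (\<lambda>v. R (map v [0..<n]) (v (n + 1)) \<and> v (n + 1) < v n)"
    by (rule definable_pred_conj[OF definable_pred_reindex[OF assms] definable_pred_atomic(1)])
  from definable_pred_not[OF definable_pred_ex[OF this, of "n + 1"]]
  have lower: "definable_pred F (\<lambda>v. \<not> (\<exists>a. R (map v [0..<n]) a \<and> a < v n))"
    by simp
  then have "definable_pred F (\<lambda>v. \<not> (\<exists>a. R (map v [0..<n]) a \<and> a < v (n + 1)) \<and> v n < v (n + 1))"
    by (intro definable_pred_conj[OF _ definable_pred_atomic(1)])
      (rule definable_pred_reindex[where Q = "\<lambda>x m. \<not> (\<exists>a. R x a \<and> a < m)"])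
  from definable_pred_not[OF definable_pred_ex[OF this, of "n + 1"]]
  have greatest: "definable_pred F (\<lambda>v. \<not> (\<exists>m. \<not> (\<exists>a. R (map v [0..<n]) a \<and> a < m) \<and> v n < m))"
    by simp
  have "isGlb UNIV {e. R (map v [0..<n]) e} (v n) \<longleftrightarrow> \<not> (\<exists>a. R (map v [0..<n]) a \<and> a < v n) \<and>
      \<not> (\<exists>m. \<not> (\<exists>a. R (map v [0..<n]) a \<and> a < m) \<and> v n < m)" for v
    by (auto simp: isGlb_UNIV_iff not_less)
  with definable_pred_conj[OF lower greatest] show ?thesis by (simp only:)
qed

text \<open>Freezing the coordinates of \<open>x\<close> to parameters makes the fibre a definable
  subset of the line. Its infimum in the extended line is finite: the element \<open>e\<close>
  excludes \<infinity> and the bound \<open>b\<close> excludes -\<infinity>.\<close>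

lemma definably_complete_isGlb:
  fixes F :: "('f, 'r, 'a::linordered_field) expansion"
  assumes F: "definably_complete F" and R: "definable_pred F (\<lambda>v. R (map v [0..<n]) (v n))"
    and x: "length x = n" and e: "R x e" and lower: "\<And>y. R x y \<Longrightarrow> b \<le> y"
  shows "\<exists>l. isGlb UNIV {y. R x y} l"
proof -
  have "map (case_sum v id \<circ> (\<lambda>i. if i < n then Inr (x ! i) else Inl 0)) [0..<n] = x"
    for v :: "nat \<Rightarrow> 'a"
    using x by (auto simp: list_eq_iff_nth_eq)
  then have "definable_pred F (\<lambda>v. R x (v 0))"
    using definable_pred_subst[OF R, of "\<lambda>i. if i < n then Inr (x ! i) else Inl 0"] by simp
  then have "definable F 1 {[y] | y. y \<in> {y. R x y}}"
    unfolding definable_iff_pred by auto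
  then obtain s where s: "isGlb UNIV (Fin ` {y. R x y}) s"
    using F unfolding definably_complete_def by blast
  then have "s \<le> Fin e" "Fin b \<le> s"
    using e lower by (auto simp: isGlb_UNIV_iff)
  then obtain l where "s = Fin l"
    by (cases s) auto
  with s have "isGlb UNIV {y. R x y} l"
    by (auto simp: isGlb_UNIV_iff) (metis less_eq_extended.simps(1))
  then show ?thesis by blast
qed

lemma definable_pred_weighted_distances:
  assumes d: "definable_metric_space F n X d" and w: "definable_fun F n A w" and A: "A \<subseteq> X"
  shows "definable_pred F
    (\<lambda>v. map v [0..<n] \<in> X \<and> (\<exists>a\<in>A. v n = w a * d (map v [0..<n]) a))"
proof -
  \<comment> \<open>Coordinates: the point \<open>x\<close>, the value, the point \<open>a\<close> (at \<open>js\<close>), then \<open>d x a\<close> and \<open>w a\<close>.\<close>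
  define I where "I = {n + 1..<2 * n + 3}"
  define js where "js = [n + 1..<2 * n + 1]"
  have len_js: "length js = n" and nth_js: "\<And>i. i < n \<Longrightarrow> js ! i = n + 1 + i"
    by (simp_all add: js_def del: upt_Suc)
  define P where "P v \<longleftrightarrow> map v ([0..<n] @ js @ [2 * n + 1]) \<in> {xs @ ys @ [d xs ys] | xs ys. xs \<in> X \<and> ys \<in> X} \<and>
    (map v js \<in> A \<and> v (2 * n + 2) = w (map v js)) \<and> v n = v (2 * n + 2) * v (2 * n + 1)" for v
  have len: "length xs = n" if "xs \<in> X" for xs
    using that d by (auto simp: definable_metric_space_def definable_def)
  have P_iff: "P v \<longleftrightarrow> map v [0..<n] \<in> X \<and> map v js \<in> A \<and> v (2 * n + 1) = d (map v [0..<n]) (map v js) \<and>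
    v (2 * n + 2) = w (map v js) \<and> v n = v (2 * n + 2) * v (2 * n + 1)" for v
  proof -
    have "map v ([0..<n] @ js @ [2 * n + 1]) \<in> {xs @ ys @ [d xs ys] | xs ys. xs \<in> X \<and> ys \<in> X} \<longleftrightarrow>
      map v [0..<n] \<in> X \<and> map v js \<in> X \<and> v (2 * n + 1) = d (map v [0..<n]) (map v js)"
    proof
      assume "map v ([0..<n] @ js @ [2 * n + 1]) \<in> {xs @ ys @ [d xs ys] | xs ys. xs \<in> X \<and> ys \<in> X}"
      then obtain xs ys where *: "map v [0..<n] @ map v js @ [v (2 * n + 1)] = xs @ ys @ [d xs ys]" "xs \<in> X" "ys \<in> X"
        by auto
      \<comment> \<open>All points of \<open>X\<close> have length \<open>n\<close>, so the
        concatenation splits in only one way.\<close>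
      then have "map v [0..<n] = xs \<and> map v js @ [v (2 * n + 1)] = ys @ [d xs ys]"
        using len by (subst (asm) append_eq_append_conv) auto
      with * show "map v [0..<n] \<in> X \<and> map v js \<in> X \<and> v (2 * n + 1) = d (map v [0..<n]) (map v js)"
        by simp
    qed auto
    with A show ?thesis unfolding P_def by blast
  qed
  have "definable_pred F P"
    unfolding P_def using d w
    by (intro definable_pred_conj[OF definable_pred_mem[where n = "n + n + 1"]
          definable_pred_conj[OF definable_pred_graph definable_pred_atomic(4)]])
      (simp_all add: definable_metric_space_def len_js)
  then have "definable_pred F (\<lambda>v. \<exists>u. P (override_on v u I))"
    by (intro definable_pred_ex_override) (simp_all add: I_def)
  moreover have "(\<exists>u. P (override_on v u I)) \<longleftrightarrow>
      map v [0..<n] \<in> X \<and> (\<exists>a\<in>A. v n = w a * d (map v [0..<n]) a)" for v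
  proof -
    have u: "map (override_on v u I) [0..<n] = map v [0..<n]" "map (override_on v u I) js = map u js"
      "override_on v u I (2 * n + 1) = u (2 * n + 1)" "override_on v u I (2 * n + 2) = u (2 * n + 2)"
      "override_on v u I n = v n" for u
      by (auto simp: I_def js_def override_on_def)
    \<comment> \<open>The block \<open>I\<close> is contiguous from \<open>n + 1\<close>, so the
      list \<open>a @ [b, c]\<close>, shifted by \<open>n + 1\<close>, prescribes all its
      coordinates.\<close>
    have "\<exists>u. map u js = a \<and> u (2 * n + 1) = b \<and> u (2 * n + 2) = c" if "a \<in> A" for a b c
    proof -
      have "length a = n" using that A len by blast
      then have "map (\<lambda>i. (a @ [b, c]) ! (i - (n + 1))) js = a"
        by (intro nth_equalityI) (simp_all add: len_js nth_js nth_append)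
      with \<open>length a = n\<close> show ?thesis
        by (intro exI[of _ "\<lambda>i. (a @ [b, c]) ! (i - (n + 1))"]) (simp add: nth_append)
    qed
    note pick = this
    show ?thesis
      unfolding P_iff u
    proof
      assume "map v [0..<n] \<in> X \<and> (\<exists>a\<in>A. v n = w a * d (map v [0..<n]) a)"
      then obtain a where a: "map v [0..<n] \<in> X" "a \<in> A" "v n = w a * d (map v [0..<n]) a"
        by blast
      obtain u where "map u js = a" "u (2 * n + 1) = d (map v [0..<n]) a" "u (2 * n + 2) = w a"
        using pick[OF a(2)] by blast
      with a show "\<exists>u. map v [0..<n] \<in> X \<and> map u js \<in> A \<and> u (2 * n + 1) = d (map v [0..<n]) (map u js) \<and>
          u (2 * n + 2) = w (map u js) \<and> v n = u (2 * n + 2) * u (2 * n + 1)"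
        by (intro exI[of _ u]) simp
    qed auto
  qed
  ultimately show ?thesis by (simp only:)
qed

text \<open>The weight \<open>g\<close> yields the numerator and the constant weight 1 the
  denominator. \<open>N\<close> is picked pointwise by choice; uniqueness of greatest lower bounds
  identifies its graph with a definable relation.\<close>

lemma definable_weighted_distance:
  assumes F: "definably_complete F" and d: "definable_metric_space F n X d"
    and w: "definable_fun F n A w" "\<And>a. a \<in> A \<Longrightarrow> 0 \<le> w a" and A: "A \<subseteq> X" "A \<noteq> {}"
  shows "\<exists>N. definable_fun F n X N \<and> (\<forall>x\<in>X. isGlb UNIV ((\<lambda>a. w a * d x a) ` A) (N x))"
proof -
  define R where "R x e \<longleftrightarrow> x \<in> X \<and> (\<exists>a\<in>A. e = w a * d x a)" for x e
  have X: "definable F n X" and d0: "\<And>x y. x \<in> X \<Longrightarrow> y \<in> X \<Longrightarrow> 0 \<le> d x y"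
    using d by (auto simp: definable_metric_space_def metric_on_def)
  have R: "definable_pred F (\<lambda>v. R (map v [0..<n]) (v n))"
    unfolding R_def by (rule definable_pred_weighted_distances[OF d w(1) A(1)])
  have "\<exists>l. isGlb UNIV {y. R x y} l" if x: "x \<in> X" for x
  proof -
    obtain a where a: "a \<in> A" using A by blast
    show ?thesis
    proof (rule definably_complete_isGlb[OF F R])
      show "length x = n" using x X by (auto simp: definable_def)
      show "R x (w a * d x a)" using x a by (auto simp: R_def)
      show "0 \<le> y" if "R x y" for y
        using that w d0 A by (auto simp: R_def subset_iff)
    qed
  qed
  then obtain N where N: "\<And>x. x \<in> X \<Longrightarrow> isGlb UNIV {y. R x y} (N x)"
    by metis
  have "definable_pred F (\<lambda>v. map v [0..<n] \<in> X \<and> isGlb UNIV {y. R (map v [0..<n]) y} (v n))"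
    by (intro definable_pred_conj definable_pred_mem[OF X] definable_pred_isGlb[where R = R] R) simp
  moreover have "(map v [0..<n] \<in> X \<and> isGlb UNIV {y. R (map v [0..<n]) y} (v n)) =
      (map v [0..<n] \<in> X \<and> v n = N (map v [0..<n]))" for v
    using N by (metis isGlb_unique)
  ultimately have "definable_fun F n X N"
    using X unfolding definable_fun_iff by (simp only:)
  moreover have "{y. R x y} = (\<lambda>a. w a * d x a) ` A" if "x \<in> X" for x
    using that by (auto simp: R_def)
  ultimately show ?thesis using N by metis
qed

section \<open>Continuity\<close>

text \<open>The non-strict bound matches what comparison of infima delivers.\<close>

lemma continuous_map_metric_topologyI:
  fixes f :: "'b \<Rightarrow> 'a::{linordered_field, linorder_topology}"
  assumes "\<And>x e. x \<in> X \<Longrightarrow> 0 < e \<Longrightarrow> \<exists>\<delta>>0. \<forall>y\<in>X. d x y < \<delta> \<longrightarrow> \<bar>f y - f x\<bar> \<le> e"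
  shows "continuous_map (metric_topology X d) euclidean f"
  unfolding continuous_map_def
proof (intro conjI allI impI)
  fix U :: "'a set" assume "openin euclidean U"
  then have "open U" by simp
  have "\<exists>\<delta>>0. \<forall>y\<in>X. d x y < \<delta> \<longrightarrow> f y \<in> U" if x: "x \<in> X" "f x \<in> U" for x
  proof -
    obtain b where b: "f x < b" "{f x..<b} \<subseteq> U"
      using open_right[OF \<open>open U\<close> x(2), of "f x + 1"] by auto
    obtain c where c: "c < f x" "{c<..f x} \<subseteq> U"
      using open_left[OF \<open>open U\<close> x(2), of "f x - 1"] by auto
    \<comment> \<open>Halving turns the non-strict bound into strict membership in the interval
      between \<open>c\<close> and \<open>b\<close>.\<close>
    define e where "e = min (b - f x) (f x - c) / 2"
    have e: "0 < e" "e < b - f x" "e < f x - c"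
      using b(1) c(1) by (auto simp: e_def min_def field_simps)
    obtain \<delta> where \<delta>: "0 < \<delta>" "\<And>y. y \<in> X \<Longrightarrow> d x y < \<delta> \<Longrightarrow> \<bar>f y - f x\<bar> \<le> e"
      using assms[OF x(1) e(1)] by blast
    have "f y \<in> U" if "y \<in> X" "d x y < \<delta>" for y
    proof (cases "f x \<le> f y")
      case True
      then have "f y \<in> {f x..<b}" using \<delta>(2)[OF that] e by auto
      then show ?thesis using b by blast
    next
      case False
      then have "f y \<in> {c<..f x}" using \<delta>(2)[OF that] e by auto
      then show ?thesis using c by blast
    qed
    with \<delta>(1) show ?thesis by blast
  qed
  then show "openin (metric_topology X d) {x \<in> topspace (metric_topology X d). f x \<in> U}"
    by (auto simp: openin_metric_topology)
qed simp

lemma continuous_map_metric_subtopologyD: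
  fixes f :: "'b \<Rightarrow> 'a::{linordered_field, linorder_topology}"
  assumes "continuous_map (subtopology (metric_topology X d) A) euclidean f"
    and "A \<subseteq> X" "a \<in> A" "0 < e"
  shows "\<exists>\<delta>>0. \<forall>x\<in>A. d a x < \<delta> \<longrightarrow> \<bar>f x - f a\<bar> < e"
proof -
  have "openin (subtopology (metric_topology X d) A) {x \<in> X \<inter> A. f x \<in> {f a - e<..<f a + e}}"
    using assms(1) unfolding continuous_map_def
    by (metis (no_types) open_greaterThanLessThan open_openin topspace_subtopology topspace_metric_topology)
  then obtain U where U: "openin (metric_topology X d) U"
    "{x \<in> X \<inter> A. f x \<in> {f a - e<..<f a + e}} = U \<inter> A"
    unfolding openin_subtopology by blast
  moreover have "a \<in> U"
    using U(2) assms by auto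
  ultimately obtain \<delta> where \<delta>: "0 < \<delta>" "\<And>y. y \<in> X \<Longrightarrow> d a y < \<delta> \<Longrightarrow> y \<in> U"
    unfolding openin_metric_topology by blast
  have "\<bar>f x - f a\<bar> < e" if "x \<in> A" "d a x < \<delta>" for x
  proof -
    have "x \<in> {x \<in> X \<inter> A. f x \<in> {f a - e<..<f a + e}}"
      using \<delta>(2)[of x] that assms(2) unfolding U(2) by blast
    then show ?thesis by (auto simp: abs_less_iff)
  qed
  with \<delta>(1) show ?thesis by blast
qed

section \<open>Lipschitz and quotient estimates\<close>

lemma metric_on_nonneg: "metric_on X d \<Longrightarrow> x \<in> X \<Longrightarrow> y \<in> X \<Longrightarrow> 0 \<le> d x y"
  by (simp add: metric_on_def)

lemma metric_on_sym: "metric_on X d \<Longrightarrow> x \<in> X \<Longrightarrow> y \<in> X \<Longrightarrow> d x y = d y x"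
  by (simp add: metric_on_def)

lemma metric_on_triangle:
  "metric_on X d \<Longrightarrow> x \<in> X \<Longrightarrow> y \<in> X \<Longrightarrow> z \<in> X \<Longrightarrow> d x z \<le> d x y + d y z"
  by (simp add: metric_on_def)

text \<open>By the triangle inequality \<open>p - K * d x y\<close> is a lower bound of the family
  at \<open>y\<close>. Exchanging \<open>x\<close> and \<open>y\<close> gives the two-sided
  estimate; weight 1 with \<open>K = 1\<close> covers the unweighted distance.\<close>

lemma weighted_distance_lipschitz:
  fixes d :: "'b \<Rightarrow> 'b \<Rightarrow> 'a::linordered_field"
  assumes d: "metric_on X d" and "A \<subseteq> X" "x \<in> X" "y \<in> X"
    and w: "\<And>a. a \<in> A \<Longrightarrow> 0 \<le> w a" "\<And>a. a \<in> A \<Longrightarrow> w a \<le> K"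
    and x: "isGlb UNIV ((\<lambda>a. w a * d x a) ` A) p" and y: "isGlb UNIV ((\<lambda>a. w a * d y a) ` A) q"
  shows "p \<le> q + K * d x y"
proof -
  have "p - K * d x y \<le> w a * d y a" if a: "a \<in> A" for a
  proof -
    have m: "0 \<le> d x y" "d x a \<le> d x y + d y a"
      using a assms(2-4) by (auto intro: metric_on_nonneg[OF d] metric_on_triangle[OF d])
    have "p \<le> w a * d x a"
      using x a by (simp add: isGlb_UNIV_iff)
    also have "\<dots> \<le> w a * (d x y + d y a)"
      using m(2) w(1)[OF a] by (rule mult_left_mono)
    also have "\<dots> \<le> K * d x y + w a * d y a"
      using mult_right_mono[OF w(2)[OF a] m(1)] by (simp add: distrib_left)
    finally show ?thesis by simp
  qed
  then have "p - K * d x y \<le> q"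
    using y by (simp add: isGlb_UNIV_iff)
  then show ?thesis by simp
qed

text \<open>The hypotheses give \<open>\<bar>N' - q * D'\<bar> \<le> (K + q) * t\<close>, and
  \<open>e * D'\<close> is at least \<open>e * (D - t)\<close>. So
  \<open>t * (q + K + e) \<le> e * D\<close> is enough, which explains the bound on
  \<open>t\<close>.\<close>

lemma quotient_continuity_estimate:
  fixes q K D N t e :: "'a::linordered_field"
  assumes N: "\<bar>N' - q * D\<bar> \<le> K * t" and D: "\<bar>D' - D\<bar> \<le> t"
    and "0 < D" "0 \<le> q" "0 < K" "0 < e" "0 \<le> t" and t: "t < e * D / (q + K + e)"
  shows "\<bar>N' / D' - q\<bar> \<le> e"
proof -
  have t': "t * (q + K + e) < e * D"
    using t assms by (simp add: field_simps)
  \<comment> \<open>The same bound on \<open>t\<close> also yields \<open>t < D\<close>, which keeps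
    the new denominator positive.\<close>
  have "t * e \<le> t * (q + K + e)"
    using assms by (intro mult_left_mono) auto
  with t' have "e * t < e * D" by (simp add: mult.commute[of e t])
  then have "t < D" using \<open>0 < e\<close> by simp
  then have "0 < D'" using D by auto
  have "q * D' \<le> q * (D + t)" "q * (D - t) \<le> q * D'" "e * (D - t) \<le> e * D'"
    using D \<open>0 \<le> q\<close> \<open>0 < e\<close> by (auto intro!: mult_left_mono)
  then have "N' \<le> (q + e) * D'" "(q - e) * D' \<le> N'"
    using N t' by (auto simp: abs_le_iff algebra_simps)
  then have "N' / D' \<le> q + e" "q - e \<le> N' / D'"
    using \<open>0 < D'\<close> by (simp_all add: pos_divide_le_eq pos_le_divide_eq)
  then show ?thesis by (simp add: abs_le_iff)
qed

text \<open>The claim amounts to \<open>(g a - e) * D \<le> N \<le> (g a + e) * D\<close>. Points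
  within \<open>r\<close> of \<open>a\<close> have weights within \<open>e\<close> of
  \<open>g a\<close>; for the remaining points the term of \<open>a\<close> itself is a sufficient
  comparison.\<close>

lemma quotient_estimate_near_closed_set:
  fixes d :: "'b \<Rightarrow> 'b \<Rightarrow> 'a::linordered_field"
  assumes d: "metric_on X d" and A: "A \<subseteq> X" "a \<in> A" and x: "x \<in> X"
    and g: "\<And>b. b \<in> A \<Longrightarrow> 1 \<le> g b" "\<And>b. b \<in> A \<Longrightarrow> g b \<le> K"
    and N: "isGlb UNIV ((\<lambda>b. g b * d x b) ` A) N" and D: "isGlb UNIV ((\<lambda>b. d x b) ` A) D" "0 < D"
    and near: "\<And>b. b \<in> A \<Longrightarrow> d a b < r \<Longrightarrow> \<bar>g b - g a\<bar> \<le> e"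
    and e: "0 < e" and close: "(K + 1) * d a x \<le> r"
  shows "\<bar>N / D - g a\<bar> \<le> e"
proof -
  have N_le: "N \<le> g b * d x b" and D_le: "D \<le> d x b" if "b \<in> A" for b
    using N D that by (auto simp: isGlb_UNIV_iff)
  have sym: "d x a = d a x"
    using A x by (intro metric_on_sym[OF d]) auto
  \<comment> \<open>Origin of the factor \<open>K + 1\<close>: \<open>d x b\<close> is at least
    \<open>r - d a x\<close>, hence at least \<open>K * d a x\<close>.\<close>
  have far: "g a * d x a \<le> d x b" if "b \<in> A" "\<not> d a b < r" for b
  proof -
    have "d a b \<le> d a x + d x b"
      using A x that by (intro metric_on_triangle[OF d]) auto
    then have "K * d a x \<le> d x b"
      using that(2) close by (simp add: algebra_simps)
    moreover have "g a * d x a \<le> K * d a x"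
      unfolding sym using A x g by (intro mult_right_mono) (auto intro: metric_on_nonneg[OF d])
    ultimately show ?thesis by simp
  qed
  have "(g a - e) * D \<le> g b * d x b" if b: "b \<in> A" for b
  proof (cases "d a b < r")
    case True
    then have "(g a - e) * D \<le> g b * D"
      using near[OF b True] D(2) by (intro mult_right_mono) (auto simp: abs_le_iff)
    also have "\<dots> \<le> g b * d x b"
      using D_le[OF b] g(1)[OF b] by (intro mult_left_mono) auto
    finally show ?thesis .
  next
    case False
    have "(g a - e) * D \<le> g a * D"
      using e D(2) by (intro mult_right_mono) auto
    also have "\<dots> \<le> g a * d x a"
      using D_le g(1) A by (intro mult_left_mono) (auto intro: order_trans[OF zero_le_one])
    also have "\<dots> \<le> d x b"
      by (rule far[OF b False])
    also have "\<dots> \<le> g b * d x b"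
      using mult_right_mono[OF g(1)[OF b], of "d x b"] D_le[OF b] D(2) by simp
    finally show ?thesis .
  qed
  then have "(g a - e) * D \<le> N"
    using N by (auto simp: isGlb_UNIV_iff)
  moreover have "N \<le> (g a + e) * D"
  proof -
    have pos: "1 \<le> g a + e" using g(1)[OF A(2)] e by simp
    have "N \<le> (g a + e) * d x b" if b: "b \<in> A" for b
    proof (cases "d a b < r")
      case True
      have "N \<le> g b * d x b" by (rule N_le[OF b])
      also have "\<dots> \<le> (g a + e) * d x b"
        using near[OF b True] D_le[OF b] D(2) by (intro mult_right_mono) (auto simp: abs_le_iff)
      finally show ?thesis .
    next
      case False
      have "N \<le> g a * d x a" by (rule N_le[OF A(2)])
      also have "\<dots> \<le> d x b" by (rule far[OF b False])
      also have "\<dots> \<le> (g a + e) * d x b"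
        using mult_right_mono[OF pos, of "d x b"] D_le[OF b] D(2) by simp
      finally show ?thesis .
    qed
    \<comment> \<open>Dividing by the positive factor gives a lower bound of the distances, which
      can then be compared with their infimum \<open>D\<close>.\<close>
    then have "\<forall>b\<in>A. N / (g a + e) \<le> d x b"
      using pos by (auto simp: pos_divide_le_eq mult.commute)
    then have "N / (g a + e) \<le> D"
      using D(1) by (auto simp: isGlb_UNIV_iff)
    then show ?thesis
      using pos by (simp add: pos_divide_le_eq mult.commute)
  qed
  ultimately have "N / D \<le> g a + e" "g a - e \<le> N / D"
    using D(2) by (simp_all add: pos_divide_le_eq pos_le_divide_eq)
  then show ?thesis by (simp add: abs_le_iff)
qed

lemma continuous_weighted_extension:
  fixes g :: "'b \<Rightarrow> 'a::linordered_field"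
  assumes d: "metric_on X d" and closed: "closedin (metric_topology X d) A" and ne: "A \<noteq> {}"
    and g: "\<And>a e. a \<in> A \<Longrightarrow> 0 < e \<Longrightarrow> \<exists>\<delta>>0. \<forall>x\<in>A. d a x < \<delta> \<longrightarrow> \<bar>g x - g a\<bar> < e"
    and bounds: "\<And>a. a \<in> A \<Longrightarrow> 1 \<le> g a" "\<And>a. a \<in> A \<Longrightarrow> g a \<le> K"
    and N: "\<And>x. x \<in> X \<Longrightarrow> isGlb UNIV ((\<lambda>a. g a * d x a) ` A) (N x)"
    and D: "\<And>x. x \<in> X \<Longrightarrow> isGlb UNIV ((\<lambda>a. d x a) ` A) (D x)"
    and x: "x \<in> X" and e: "0 < e"
  defines "f \<equiv> \<lambda>x. if x \<in> A then g x else N x / D x"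
  shows "\<exists>\<delta>>0. \<forall>y\<in>X. d x y < \<delta> \<longrightarrow> \<bar>f y - f x\<bar> \<le> e"
proof -
  have A: "A \<subseteq> X"
    using closedin_subset[OF closed] by simp
  obtain a0 where "a0 \<in> A" using ne by blast
  with bounds have K: "1 \<le> K" by (meson order_trans)
  have isolated: "\<exists>r>0. \<forall>y\<in>X. d x y < r \<longrightarrow> y \<notin> A" if "x \<in> X" "x \<notin> A" for x
  proof -
    have "openin (metric_topology X d) (X - A)"
      using closed by (simp add: closedin_def)
    with that show ?thesis unfolding openin_metric_topology by blast
  qed
  \<comment> \<open>A ball around \<open>x\<close> misses the closed set \<open>A\<close>, and its
    radius is a lower bound of the distances.\<close>
  have D_pos: "0 < D x" if x: "x \<in> X" "x \<notin> A" for x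
  proof -
    obtain r where r: "0 < r" "\<And>y. y \<in> X \<Longrightarrow> d x y < r \<Longrightarrow> y \<notin> A"
      using isolated[OF x] by blast
    then have "\<forall>a\<in>A. r \<le> d x a"
      using A by (meson not_le subsetD)
    then have "r \<le> D x"
      using D[OF x(1)] by (simp add: isGlb_UNIV_iff)
    with r(1) show ?thesis by simp
  qed
  show ?thesis
  proof (cases "x \<in> A")
    case True
    obtain r where r: "0 < r" "\<And>y. y \<in> A \<Longrightarrow> d x y < r \<Longrightarrow> \<bar>g y - g x\<bar> < e"
      using g[OF True e] by blast
    \<comment> \<open>This radius serves both kinds of \<open>y\<close>: off \<open>A\<close> the
      quotient estimate needs \<open>(K + 1) * d x y \<le> r\<close>, and in \<open>A\<close> the
      weaker consequence \<open>d x y < r\<close> suffices.\<close>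
    have "\<bar>f y - f x\<bar> \<le> e" if y: "y \<in> X" "d x y < r / (K + 1)" for y
    proof -
      have "(K + 1) * d x y < r"
        using y(2) K by (simp add: pos_less_divide_eq mult.commute)
      moreover have "0 \<le> d x y"
        by (rule metric_on_nonneg[OF d x y(1)])
      then have "d x y \<le> (K + 1) * d x y"
        using K mult_right_mono[of 1 "K + 1" "d x y"] by simp
      ultimately have *: "d x y < r" "(K + 1) * d x y \<le> r"
        by simp_all
      show ?thesis
      proof (cases "y \<in> A")
        case y_in: True
        then show ?thesis using r(2)[OF y_in *(1)] True by (simp add: f_def)
      next
        case y_notin: False
        have "\<bar>N y / D y - g x\<bar> \<le> e"
          using quotient_estimate_near_closed_set[OF d A True y(1) bounds N[OF y(1)] D[OF y(1)]
              D_pos[OF y(1) y_notin] _ e *(2)] r(2) by (simp add: less_imp_le)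
        with True y_notin show ?thesis by (simp add: f_def)
      qed
    qed
    moreover have "0 < r / (K + 1)"
      using r(1) K by simp
    ultimately show ?thesis by blast
  next
    case False
    obtain r where r: "0 < r" "\<And>y. y \<in> X \<Longrightarrow> d x y < r \<Longrightarrow> y \<notin> A"
      using isolated[OF x False] by blast
    define q where "q = N x / D x"
    have "0 \<le> N x"
    proof -
      have "0 \<le> g a * d x a" if "a \<in> A" for a
        using bounds(1)[OF that] metric_on_nonneg[OF d x, of a] A that by auto
      then show ?thesis using N[OF x] by (simp add: isGlb_UNIV_iff)
    qed
    then have q: "0 \<le> q" "q * D x = N x"
      using D_pos[OF x False] by (simp_all add: q_def)
    \<comment> \<open>The bound \<open>r\<close> keeps \<open>y\<close> outside \<open>A\<close>, so
      that \<open>f y\<close> is again a quotient; the second term is the threshold of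
      \<open>quotient_continuity_estimate\<close>.\<close>
    define \<delta> where "\<delta> = min r (e * D x / (q + K + e))"
    have "\<bar>f y - f x\<bar> \<le> e" if y: "y \<in> X" "d x y < \<delta>" for y
    proof -
      have m: "0 \<le> d x y" "d y x = d x y"
        using metric_on_nonneg[OF d x y(1)] metric_on_sym[OF d x y(1)] by simp_all
      have w: "0 \<le> g a" "g a \<le> K" if "a \<in> A" for a
        using bounds[OF that] by (auto intro: order_trans[OF zero_le_one])
      have "\<bar>N y - q * D x\<bar> \<le> K * d x y"
        using weighted_distance_lipschitz[OF d A x y(1) w N[OF x] N[OF y(1)]]
          weighted_distance_lipschitz[OF d A y(1) x w N[OF y(1)] N[OF x]] m(2)
        by (simp add: abs_le_iff q(2))
      moreover have "\<bar>D y - D x\<bar> \<le> d x y"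
        using weighted_distance_lipschitz[OF d A x y(1), of "\<lambda>_. 1" 1 "D x" "D y"] D[OF x] D[OF y(1)]
          weighted_distance_lipschitz[OF d A y(1) x, of "\<lambda>_. 1" 1 "D y" "D x"] m(2)
        by (simp add: abs_le_iff)
      ultimately have "\<bar>N y / D y - q\<bar> \<le> e"
        using y(2) K D_pos[OF x False] q(1) e m(1)
        by (intro quotient_continuity_estimate[where K = K and t = "d x y"]) (auto simp: \<delta>_def)
      moreover have "y \<notin> A"
        using r(2) y by (simp add: \<delta>_def)
      ultimately show ?thesis
        using False by (simp add: f_def q_def)
    qed
    moreover have "0 < \<delta>"
      using r(1) e D_pos[OF x False] q(1) K by (simp add: \<delta>_def)
    ultimately show ?thesis by blast
  qed
qed

theorem theoremA2:
  fixes F :: "('f, 'r, 'a::{linordered_field, linorder_topology}) expansion"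
    and X A :: "'a list set" and d :: "'a list \<Rightarrow> 'a list \<Rightarrow> 'a"
    and \<phi> :: "'a list \<Rightarrow> 'a" and n :: nat
  assumes "definably_complete F"
    and "definable_metric_space F n X d"
    and "definable F n A" and "A \<noteq> {}" and "closedin (metric_topology X d) A"
    and "definable_fun F n A \<phi>"
    and "bdd_above (\<phi> ` A)" and "bdd_below (\<phi> ` A)"
    and "continuous_map (subtopology (metric_topology X d) A) euclidean \<phi>"
  shows "\<exists>\<Phi> :: 'a list \<Rightarrow> 'a.
           definable_fun F n X \<Phi> \<and>
           continuous_map (metric_topology X d) euclidean \<Phi> \<and>
           (\<forall>x\<in>A. \<Phi> x = \<phi> x)"
proof -
  have d: "metric_on X d"
    using assms(2) by (simp add: definable_metric_space_def)
  have A: "A \<subseteq> X"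
    using closedin_subset[OF assms(5)] by simp
  obtain b where b: "\<And>a. a \<in> A \<Longrightarrow> b \<le> \<phi> a"
    using assms(8) by (auto simp: bdd_below_def)
  obtain B where B: "\<And>a. a \<in> A \<Longrightarrow> \<phi> a \<le> B"
    using assms(7) by (auto simp: bdd_above_def)
  \<comment> \<open>The shift moves the lower bound \<open>b\<close> to 1 and makes
    \<open>K = B + (1 - b)\<close>; it is undone in \<open>\<Phi>\<close>.\<close>
  define g where "g x = \<phi> x + (1 - b)" for x
  have g: "definable_fun F n A g"
    unfolding g_def by (rule definable_fun_add_const[OF assms(6)])
  have bounds: "1 \<le> g a" "g a \<le> B + (1 - b)" if "a \<in> A" for a
    using b[OF that] B[OF that] by (simp_all add: g_def)
  obtain N where N: "definable_fun F n X N"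
    "\<And>x. x \<in> X \<Longrightarrow> isGlb UNIV ((\<lambda>a. g a * d x a) ` A) (N x)"
    using definable_weighted_distance[OF assms(1,2) g _ A assms(4)] bounds(1)
    by (meson order_trans zero_le_one)
  obtain D where D: "definable_fun F n X D"
    "\<And>x. x \<in> X \<Longrightarrow> isGlb UNIV ((\<lambda>a. d x a) ` A) (D x)"
    using definable_weighted_distance[OF assms(1,2) definable_fun_const[OF assms(3), of 1] _ A assms(4)]
    by auto
  define f where "f x = (if x \<in> A then g x else N x / D x)" for x
  define \<Phi> where "\<Phi> x = f x + (b - 1)" for x
  have "definable_fun F n X \<Phi>"
    unfolding \<Phi>_def f_def
    by (intro definable_fun_add_const definable_fun_if[OF g _ A] definable_fun_divide N(1) D(1))
  moreover have "continuous_map (metric_topology X d) euclidean \<Phi>"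
  proof (rule continuous_map_metric_topologyI)
    fix x and e :: 'a
    assume x: "x \<in> X" and e: "0 < e"
    have g_continuous: "\<exists>\<delta>>0. \<forall>x\<in>A. d a x < \<delta> \<longrightarrow> \<bar>g x - g a\<bar> < e" if "a \<in> A" "0 < e" for a e
      using continuous_map_metric_subtopologyD[OF assms(9) A that] by (simp add: g_def)
    show "\<exists>\<delta>>0. \<forall>y\<in>X. d x y < \<delta> \<longrightarrow> \<bar>\<Phi> y - \<Phi> x\<bar> \<le> e"
      using continuous_weighted_extension[OF d assms(5,4) g_continuous bounds N(2) D(2) x e]
      by (simp add: \<Phi>_def f_def)
  qed
  moreover have "\<forall>x\<in>A. \<Phi> x = \<phi> x"
    by (simp add: \<Phi>_def f_def g_def)
  ultimately show ?thesis by blast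
qed

end
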